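(* For $(M^0,M^1)\in\mathcal M(\theta_0,\theta_1,\theta_\infty)$ let $x_0=m^0_{11}$, $x_1=m^1_{11}$, $x_2=\mathrm{tr}(M^1M^0)$, let $M^j_{(1)}=M^1M^0\,M^j\,(M^1M^0)^{-1}=(m^j_{(1),kl})$ for $j=0,1$, and write $x_0^{(1)}=m^0_{(1),11}$, $x_1^{(1)}=m^1_{(1),11}$, $x_2^{(1)}=\mathrm{tr}(M^1_{(1)}M^0_{(1)})$. Then $(x_0^{(1)},x_1^{(1)},x_2^{(1)})\in\mathbf V_{(\theta_0,\theta_1,\theta_\infty)}$, and $$x_0^{(1)}=-x_1x_2-x_0+\mathrm{tr}M^0+e^{-\pi i\theta_\infty}\mathrm{tr}M^1,$$ $$x_1^{(1)}=x_1x_2^2+x_0x_2-x_1-(\mathrm{tr}M^0+e^{-\pi i\theta_\infty}\mathrm{tr}M^1)x_2+\mathrm{tr}M^1+e^{-\pi i\theta_\infty}\mathrm{tr}M^0,$$ $$x_2^{(1)}=x_2.$$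
   Context: $\theta_0,\theta_1,\theta_\infty\in\mathbb{C}$; $\sigma_3=\mathrm{diag}(1,-1)$. $\mathcal M(\theta_0,\theta_1,\theta_\infty)$ is the set of pairs $(M^0,M^1)\in SL_2(\mathbb{C})^2$, $M^0=(m^0_{kl})$, $M^1=(m^1_{kl})$, satisfying $m^0_{11}m^1_{11}+m^0_{21}m^1_{12}=e^{-\pi i\theta_\infty}$, $\mathrm{tr}M^0=2\cos\pi\theta_0$, $\mathrm{tr}M^1=2\cos\pi\theta_1$, modulo $(M^0,M^1)\sim c^{\sigma_3}(M^0,M^1)c^{-\sigma_3}$, $c\in\mathbb{C}\setminus\{0\}$. The character variety is $$\mathbf V_{(\theta_0,\theta_1,\theta_\infty)}:\ x_0x_1x_2+x_0^2+x_1^2-\mu_0x_0-\mu_1x_1-e^{-\pi i\theta_\infty}x_2+\kappa=0,$$ where, with $T_0=2\cos\pi\theta_0$ $(=\mathrm{tr}M^0)$, $T_1=2\cos\pi\theta_1$ $(=\mathrm{tr}M^1)$, $\mu_0=T_0+e^{-\pi i\theta_\infty}T_1$, $\mu_1=T_1+e^{-\pi i\theta_\infty}T_0$, $\kappa=e^{-2\pi i\theta_\infty}+e^{-\pi i\theta_\infty}T_0T_1+1$. *)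

theory Defs
  imports "HOL-Analysis.Analysis"
begin

definition SL2 :: "(complex^2^2) set" where
  "SL2 = {M. det M = 1}"

text \<open>The matrix \<open>c\<^bsup>\<sigma>\<^sub>3\<^esup> = diag (c, c\<^sup>-\<^sup>1)\<close> with \<open>\<sigma>\<^sub>3 = diag (1, -1)\<close>; for \<open>c \<noteq> 0\<close> one has
  \<open>c\<^bsup>-\<sigma>\<^sub>3\<^esup> = (c\<^sup>-\<^sup>1)\<^bsup>\<sigma>\<^sub>3\<^esup>\<close>.\<close>

definition pow_sigma3 :: "complex \<Rightarrow> complex^2^2" where
  "pow_sigma3 c = vector [vector [c, 0], vector [0, inverse c]]"

definition conj_sigma3 :: "complex \<Rightarrow> complex^2^2 \<Rightarrow> complex^2^2" where
  "conj_sigma3 c M = pow_sigma3 c ** M ** pow_sigma3 (inverse c)"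

definition monodromy_pairs ::
  "complex \<Rightarrow> complex \<Rightarrow> complex \<Rightarrow> ((complex^2^2) \<times> (complex^2^2)) set" where
  "monodromy_pairs \<theta>0 \<theta>1 \<theta>inf =
    {(M0, M1). M0 \<in> SL2 \<and> M1 \<in> SL2 \<and>
       M0$1$1 * M1$1$1 + M0$2$1 * M1$1$2 = exp (- (complex_of_real pi * \<i> * \<theta>inf)) \<and>
       trace M0 = 2 * cos (complex_of_real pi * \<theta>0) \<and>
       trace M1 = 2 * cos (complex_of_real pi * \<theta>1)}"

definition monodromy_rel ::
  "complex \<Rightarrow> complex \<Rightarrow> complex \<Rightarrow>
    (((complex^2^2) \<times> (complex^2^2)) \<times> ((complex^2^2) \<times> (complex^2^2))) set" where
  "monodromy_rel \<theta>0 \<theta>1 \<theta>inf =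
    {((M0, M1), (N0, N1)).
       (M0, M1) \<in> monodromy_pairs \<theta>0 \<theta>1 \<theta>inf \<and> (N0, N1) \<in> monodromy_pairs \<theta>0 \<theta>1 \<theta>inf \<and>
       (\<exists>c. c \<noteq> 0 \<and> N0 = conj_sigma3 c M0 \<and> N1 = conj_sigma3 c M1)}"

definition monodromy_manifold ::
  "complex \<Rightarrow> complex \<Rightarrow> complex \<Rightarrow> ((complex^2^2) \<times> (complex^2^2)) set set" where
  "monodromy_manifold \<theta>0 \<theta>1 \<theta>inf =
    monodromy_pairs \<theta>0 \<theta>1 \<theta>inf // monodromy_rel \<theta>0 \<theta>1 \<theta>inf"

definition character_variety ::
  "complex \<Rightarrow> complex \<Rightarrow> complex \<Rightarrow> (complex \<times> complex \<times> complex) set" where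
  "character_variety \<theta>0 \<theta>1 \<theta>inf =
    (let q = exp (- (complex_of_real pi * \<i> * \<theta>inf));
         T0 = 2 * cos (complex_of_real pi * \<theta>0);
         T1 = 2 * cos (complex_of_real pi * \<theta>1);
         \<mu>0 = T0 + q * T1;
         \<mu>1 = T1 + q * T0;
         \<kappa> = exp (- (2 * complex_of_real pi * \<i> * \<theta>inf)) + q * T0 * T1 + 1
     in {(x0, x1, x2).
           x0 * x1 * x2 + x0^2 + x1^2 - \<mu>0 * x0 - \<mu>1 * x1 - q * x2 + \<kappa> = 0})"

lemma conj_sigma3_nth:
  "conj_sigma3 c M $ 1 $ 1 = c * M$1$1 * inverse c"
  "conj_sigma3 c M $ 1 $ 2 = c * M$1$2 * c"
  "conj_sigma3 c M $ 2 $ 1 = inverse c * M$2$1 * inverse c"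
  "conj_sigma3 c M $ 2 $ 2 = inverse c * M$2$2 * c"
  by (simp_all add: conj_sigma3_def pow_sigma3_def matrix_matrix_mult_def sum_2)

lemma mat2_eq_iff:
  fixes A B :: "complex^2^2"
  shows "A = B \<longleftrightarrow> A$1$1 = B$1$1 \<and> A$1$2 = B$1$2 \<and> A$2$1 = B$2$1 \<and> A$2$2 = B$2$2"
  by (auto simp: vec_eq_iff forall_2)

lemma conj_sigma3_one: "conj_sigma3 1 M = M"
  by (simp add: mat2_eq_iff conj_sigma3_nth)

lemma conj_sigma3_comp: "conj_sigma3 c (conj_sigma3 d M) = conj_sigma3 (c * d) M"
  by (simp add: mat2_eq_iff conj_sigma3_nth mult_ac)

lemma equiv_monodromy_rel:
  "equiv (monodromy_pairs \<theta>0 \<theta>1 \<theta>inf) (monodromy_rel \<theta>0 \<theta>1 \<theta>inf)"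
proof (rule equivI)
  show "monodromy_rel \<theta>0 \<theta>1 \<theta>inf
      \<subseteq> monodromy_pairs \<theta>0 \<theta>1 \<theta>inf \<times> monodromy_pairs \<theta>0 \<theta>1 \<theta>inf"
    by (auto simp: monodromy_rel_def)
  show "refl_on (monodromy_pairs \<theta>0 \<theta>1 \<theta>inf) (monodromy_rel \<theta>0 \<theta>1 \<theta>inf)"
    unfolding refl_on_def monodromy_rel_def
    by (auto intro!: exI[of _ "1::complex"] simp: conj_sigma3_one)
  show "sym (monodromy_rel \<theta>0 \<theta>1 \<theta>inf)"
  proof (rule symI)
    fix p r assume "(p, r) \<in> monodromy_rel \<theta>0 \<theta>1 \<theta>inf"
    then show "(r, p) \<in> monodromy_rel \<theta>0 \<theta>1 \<theta>inf"
      unfolding monodromy_rel_def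
      apply clarsimp
      subgoal for M0 M1 c
        by (rule exI[of _ "inverse c"]) (simp add: conj_sigma3_comp conj_sigma3_one)
      done
  qed
  show "trans (monodromy_rel \<theta>0 \<theta>1 \<theta>inf)"
  proof (rule transI)
    fix p r s
    assume "(p, r) \<in> monodromy_rel \<theta>0 \<theta>1 \<theta>inf" "(r, s) \<in> monodromy_rel \<theta>0 \<theta>1 \<theta>inf"
    then show "(p, s) \<in> monodromy_rel \<theta>0 \<theta>1 \<theta>inf"
      unfolding monodromy_rel_def
      apply clarsimp
      subgoal for M0 M1 c d
        by (rule exI[of _ "d * c"]) (simp add: conj_sigma3_comp)
      done
  qed
qed

text \<open>The coordinates \<open>(x\<^sub>0, x\<^sub>1, x\<^sub>2)\<close> depend only on the class of \<open>(M\<^sup>0, M\<^sup>1)\<close>.\<close>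

lemma monodromy_coordinates_congruent:
  "(\<lambda>(M0, M1). (M0$1$1, M1$1$1, trace (M1 ** M0))) respects monodromy_rel \<theta>0 \<theta>1 \<theta>inf"
  by (rule congruentI)
    (auto simp: monodromy_rel_def conj_sigma3_nth trace_def matrix_matrix_mult_def sum_2 field_simps)

end

theory Submission
  imports Defs
begin

text \<open>
  Write \<open>P = M1 ** M0\<close>. Simultaneous conjugation by \<open>P\<close> is the square of the half twist
  \<open>(A, B) \<mapsto> (B, B ** A ** matrix_inv B)\<close>: applied twice, the half twist sends \<open>(M0, M1)\<close> to
  \<open>(P ** M0 ** matrix_inv P, P ** M1 ** matrix_inv P)\<close>.
  The half twist preserves the product \<open>B ** A\<close>, whose upper left entry is the quantity
  fixed to be \<open>exp (- \<pi> \<i> \<theta>inf)\<close> in the definition of monodromy pairs, and it exchanges the two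
  local traces; so it maps monodromy pairs for \<open>(\<theta>0, \<theta>1)\<close> to those for \<open>(\<theta>1, \<theta>0)\<close>
  (\<open>half_twist_monodromy_pairs\<close>). As \<open>B\<close> has determinant one, its inverse is
  \<open>mat (trace B) - B\<close>, so that the upper left entry of \<open>B ** A ** matrix_inv B\<close> becomes
  a polynomial in the coordinates (\<open>half_twist_entry_11\<close>).
  Using that formula twice gives the expressions for \<open>x0'\<close> and \<open>x1'\<close>, and \<open>x2'\<close> is the trace
  of the preserved product.

  Finally, the coordinates of every monodromy pair satisfy the cubic equation
  (\<open>monodromy_pair_in_character_variety\<close>), and the conjugated pair is again a monodromy pair.
\<close>

lemma matrix_mult_2_nth:
  fixes A B :: "'a::semiring_1^2^2"
  shows "(A ** B) $ i $ j = A$i$1 * B$1$j + A$i$2 * B$2$j"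
  by (simp add: matrix_matrix_mult_def sum_2)

lemma trace_2:
  fixes A :: "'a::semiring_1^2^2"
  shows "trace A = A$1$1 + A$2$2"
  by (simp add: trace_def sum_2)

lemma matrix_inv_SL2:
  assumes "A \<in> SL2"
  shows "A ** matrix_inv A = mat 1" "matrix_inv A ** A = mat 1"
proof -
  have "\<exists>A'. A ** A' = mat 1 \<and> A' ** A = mat 1"
    using assms by (simp add: SL2_def invertible_det_nz[unfolded invertible_def])
  then have "A ** matrix_inv A = mat 1 \<and> matrix_inv A ** A = mat 1"
    unfolding matrix_inv_def by (rule someI_ex)
  then show "A ** matrix_inv A = mat 1" "matrix_inv A ** A = mat 1"
    by simp_all
qed

text \<open>Cayley--Hamilton for determinant one.\<close>

lemma matrix_inv_SL2_eq:
  assumes "A \<in> SL2"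
  shows "matrix_inv A = mat (trace A) - A"
proof -
  have "A$1$1 * A$2$2 - A$1$2 * A$2$1 = 1"
    using assms by (simp add: SL2_def det_2)
  then have "A ** (mat (trace A) - A) = mat 1"
    by (simp add: mat2_eq_iff matrix_mult_2_nth mat_def trace_2 algebra_simps)
  then have "matrix_inv A ** (A ** (mat (trace A) - A)) = matrix_inv A"
    by simp
  then show ?thesis
    by (simp add: matrix_mul_assoc matrix_inv_SL2(2)[OF assms])
qed

lemma matrix_mult_SL2: "A \<in> SL2 \<Longrightarrow> B \<in> SL2 \<Longrightarrow> A ** B \<in> SL2"
  by (simp add: SL2_def det_mul)

lemma conj_SL2:
  assumes "A \<in> SL2" "B \<in> SL2"
  shows "B ** A ** matrix_inv B \<in> SL2"
proof -
  have "det B * det (matrix_inv B) = 1"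
    using matrix_inv_SL2(1)[OF assms(2)] by (metis det_I det_mul)
  then show ?thesis
    using assms by (simp add: SL2_def det_mul)
qed

lemma trace_conj_SL2:
  assumes "B \<in> SL2"
  shows "trace (B ** A ** matrix_inv B) = trace A"
  by (metis assms matrix_inv_SL2(2) matrix_mul_assoc matrix_mul_rid trace_mul_sym)

lemma half_twist_product:
  assumes "B \<in> SL2"
  shows "(B ** A ** matrix_inv B) ** B = B ** A"
  by (metis assms matrix_inv_SL2(2) matrix_mul_assoc matrix_mul_rid)

lemma monodromy_pairs_iff:
  "(A, B) \<in> monodromy_pairs \<theta>0 \<theta>1 \<theta>inf \<longleftrightarrow>
     A \<in> SL2 \<and> B \<in> SL2 \<and> (B ** A) $ 1 $ 1 = exp (- (complex_of_real pi * \<i> * \<theta>inf)) \<and>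
     trace A = 2 * cos (complex_of_real pi * \<theta>0) \<and>
     trace B = 2 * cos (complex_of_real pi * \<theta>1)"
  by (simp add: monodromy_pairs_def matrix_mult_2_nth mult.commute)

lemma half_twist_monodromy_pairs:
  assumes "(A, B) \<in> monodromy_pairs \<theta>0 \<theta>1 \<theta>inf"
  shows "(B, B ** A ** matrix_inv B) \<in> monodromy_pairs \<theta>1 \<theta>0 \<theta>inf"
  using assms
  by (auto simp: monodromy_pairs_iff conj_SL2 trace_conj_SL2 half_twist_product)

lemma half_twist_entry_11:
  assumes "A \<in> SL2" "B \<in> SL2"
  shows "(B ** A ** matrix_inv B) $ 1 $ 1 =
    - B$1$1 * trace (B ** A) - A$1$1 + trace A + (B ** A)$1$1 * trace B"
proof -
  have "B$1$1 * B$2$2 - B$1$2 * B$2$1 = 1"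
    using assms by (simp add: SL2_def det_2)
  then show ?thesis
    unfolding matrix_inv_SL2_eq[OF assms(2)]
    by (simp add: matrix_mult_2_nth mat_def trace_2) algebra
qed

text \<open>
  Let \<open>a, b, c, d\<close> be the entries of \<open>A\<close> and \<open>e, f, g, h\<close> those of \<open>B\<close>, row by row. The
  equation of the character variety is \<open>(f * c) * (g * b) = (b * c) * (f * g)\<close>: on the left,
  \<open>f * c\<close> and \<open>g * b\<close> are read off from the upper left entry and the trace of \<open>B ** A\<close>, and on
  the right, \<open>b * c\<close> and \<open>f * g\<close> from the two determinants.
\<close>

lemma monodromy_pair_in_character_variety:
  assumes "(A, B) \<in> monodromy_pairs \<theta>0 \<theta>1 \<theta>inf"
  shows "(A$1$1, B$1$1, trace (B ** A)) \<in> character_variety \<theta>0 \<theta>1 \<theta>inf"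
proof -
  define q where "q = exp (- (complex_of_real pi * \<i> * \<theta>inf))"
  define a b c d where "a = A$1$1" and "b = A$1$2" and "c = A$2$1" and "d = A$2$2"
  define e f g h where "e = B$1$1" and "f = B$1$2" and "g = B$2$1" and "h = B$2$2"
  note entries = a_def b_def c_def d_def e_def f_def g_def h_def
  have dets: "b * c = a * d - 1" "f * g = e * h - 1"
    using assms by (auto simp: monodromy_pairs_iff SL2_def det_2 entries algebra_simps)
  have q: "f * c = q - e * a"
    using assms by (auto simp: monodromy_pairs_iff matrix_mult_2_nth q_def entries algebra_simps)
  have traces: "2 * cos (complex_of_real pi * \<theta>0) = a + d"
               "2 * cos (complex_of_real pi * \<theta>1) = e + h"
    using assms by (simp_all add: monodromy_pairs_iff trace_2 entries)
  have x2: "trace (B ** A) = q + g * b + h * d"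
    using q by (simp add: trace_2 matrix_mult_2_nth entries)
  have q_sq: "exp (- (2 * complex_of_real pi * \<i> * \<theta>inf)) = q\<^sup>2"
    by (simp add: q_def exp_double[symmetric] mult.assoc)
  have "(q - e * a) * (g * b) = (a * d - 1) * (e * h - 1)"
    using dets q by (metis mult.assoc mult.commute mult.left_commute)
  then have "a * e * (q + g * b + h * d) + a\<^sup>2 + e\<^sup>2
      - ((a + d) + q * (e + h)) * a - ((e + h) + q * (a + d)) * e
      - q * (q + g * b + h * d) + (q\<^sup>2 + q * (a + d) * (e + h) + 1) = 0"
    by algebra
  then show ?thesis
    unfolding character_variety_def Let_def traces x2 q_sq q_def[symmetric]
    by (simp add: a_def[symmetric] e_def[symmetric])
qed

text \<open>Conjugation by \<open>B ** A\<close> is the full twist.\<close>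

lemma full_twist:
  assumes "A \<in> SL2" "B \<in> SL2"
  defines "P \<equiv> B ** A" and "A' \<equiv> B ** A ** matrix_inv B"
  shows "P ** A ** matrix_inv P = A'" and "P ** B ** matrix_inv P = A' ** B ** matrix_inv A'"
proof -
  have P: "P \<in> SL2" and A': "A' \<in> SL2"
    using assms by (simp_all add: matrix_mult_SL2 conj_SL2)
  have P_eq: "A' ** B = P"
    using assms by (simp add: half_twist_product)
  have conj_eqI: "X ** Y ** matrix_inv X = Z" if "X \<in> SL2" "X ** Y = Z ** X" for X Y Z
    by (metis that matrix_inv_SL2(1) matrix_mul_assoc matrix_mul_rid)
  show A'_eq: "P ** A ** matrix_inv P = A'"
    by (rule conj_eqI[OF P]) (metis P_eq P_def matrix_mul_assoc)
  have "P ** B = A' ** B ** matrix_inv A' ** P"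
    by (metis A' P_eq matrix_inv_SL2(2) matrix_mul_assoc matrix_mul_rid)
  then show "P ** B ** matrix_inv P = A' ** B ** matrix_inv A'"
    by (rule conj_eqI[OF P])
qed

theorem corollary2p19:
  fixes \<theta>0 \<theta>1 \<theta>inf :: complex
    and C :: "((complex^2^2) \<times> (complex^2^2)) set"
    and M0 M1 M0' M1' :: "complex^2^2"
    and x0 x1 x2 x0' x1' x2' :: complex
  assumes "C \<in> monodromy_manifold \<theta>0 \<theta>1 \<theta>inf" and "(M0, M1) \<in> C"
    and "x0 = M0$1$1" and "x1 = M1$1$1" and "x2 = trace (M1 ** M0)"
    and "M0' = (M1 ** M0) ** M0 ** matrix_inv (M1 ** M0)"
    and "M1' = (M1 ** M0) ** M1 ** matrix_inv (M1 ** M0)"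
    and "x0' = M0'$1$1" and "x1' = M1'$1$1" and "x2' = trace (M1' ** M0')"
  shows "(x0', x1', x2') \<in> character_variety \<theta>0 \<theta>1 \<theta>inf
    \<and> x0' = - x1 * x2 - x0 + trace M0 + exp (- (complex_of_real pi * \<i> * \<theta>inf)) * trace M1
    \<and> x1' = x1 * x2^2 + x0 * x2 - x1
          - (trace M0 + exp (- (complex_of_real pi * \<i> * \<theta>inf)) * trace M1) * x2
          + trace M1 + exp (- (complex_of_real pi * \<i> * \<theta>inf)) * trace M0
    \<and> x2' = x2"
proof -
  define q where "q = exp (- (complex_of_real pi * \<i> * \<theta>inf))"
  have pair: "(M0, M1) \<in> monodromy_pairs \<theta>0 \<theta>1 \<theta>inf"
    using assms(1,2) in_quotient_imp_subset[OF equiv_monodromy_rel]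
    unfolding monodromy_manifold_def by blast
  then have SL2: "M0 \<in> SL2" "M1 \<in> SL2" and q: "(M1 ** M0) $ 1 $ 1 = q"
    by (simp_all add: monodromy_pairs_iff q_def)
  have M0': "M0' = M1 ** M0 ** matrix_inv M1"
    and M1': "M1' = M0' ** M1 ** matrix_inv M0'"
    using full_twist[OF SL2] assms(6,7) by simp_all
  have pair_half: "(M1, M0') \<in> monodromy_pairs \<theta>1 \<theta>0 \<theta>inf"
    using half_twist_monodromy_pairs[OF pair] by (simp add: M0')
  then have pair': "(M0', M1') \<in> monodromy_pairs \<theta>0 \<theta>1 \<theta>inf"
    using half_twist_monodromy_pairs by (simp add: M1')
  have SL2': "M0' \<in> SL2"
    using pair' by (simp add: monodromy_pairs_iff)
  have product_half: "M0' ** M1 = M1 ** M0"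
    using half_twist_product[OF SL2(2)] by (simp add: M0')
  then have "M1' ** M0' = M1 ** M0"
    using half_twist_product[OF SL2', of M1] by (simp add: M1')
  then have x2': "x2' = x2"
    using assms(5,10) by simp
  have x0': "x0' = - x1 * x2 - x0 + trace M0 + q * trace M1"
    using half_twist_entry_11[OF SL2] assms(3-5,8) q by (simp add: M0')
  have trace_M0': "trace M0' = trace M0"
    using trace_conj_SL2[OF SL2(2)] by (simp add: M0')
  \<comment> \<open>The second half twist acts on \<open>(M1, M0')\<close>, where the roles of the two traces are exchanged.\<close>
  have "x1' = - x0' * x2 - x1 + trace M1 + q * trace M0"
    using half_twist_entry_11[OF SL2(2) SL2', folded M1'] assms(4,5,8,9) q
    by (simp add: product_half trace_M0')
  then have x1': "x1' = x1 * x2^2 + x0 * x2 - x1 - (trace M0 + q * trace M1) * x2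
      + trace M1 + q * trace M0"
    by (simp add: x0' algebra_simps power2_eq_square)
  have "(x0', x1', x2') \<in> character_variety \<theta>0 \<theta>1 \<theta>inf"
    using monodromy_pair_in_character_variety[OF pair'] assms(8-10) by simp
  then show ?thesis
    using x0' x1' x2' unfolding q_def by blast
qed

end
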